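(* Let $R$ be a (von Neumann) regular ring and let $A,B$ be elements of the lattice $L(R)$ of principal right ideals of $R$. If $A\cap B$ is of finite height in $L(R)$, then $A$ and $B$ are perspective in $L(R)$ if and only if they are isomorphic as right $R$-modules.
   Context: Rings are associative with unit. A ring $R$ is (von Neumann) regular if for each $a\in R$ there is $x\in R$ with $axa=a$. For a regular ring $R$, the principal right ideals form a complemented sublattice $L(R)$ of the (modular) lattice of all right ideals (join is sum, meet is intersection). An element $a$ of a modular lattice with $0$ is of finite height $d$ if some (equivalently each) maximal chain in $[0,a]$ has $d+1$ elements. Two elements of a complemented modular lattice are perspective if they have a common complement. *)

theory Defs
  imports "HOL-Algebra.Algebra"
begin

locale regular_ring = ring +
  assumes regular: "a \<in> carrier R \<Longrightarrow> \<exists>x \<in> carrier R. a \<otimes> x \<otimes> a = a"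

(* The principal right ideal generated by a is the coset a <# carrier R = {a r | r in R}. *)
definition principal_right_ideals :: "('a, 'm) ring_scheme \<Rightarrow> 'a set set" where
  "principal_right_ideals R = {a <#\<^bsub>R\<^esub> carrier R | a. a \<in> carrier R}"

(* The lattice L(R). Its meets and joins are those of the inclusion order; for regular R
   they are the intersection and the sum, so L(R) is a sublattice of all right ideals. *)
definition pri_lattice :: "('a, 'm) ring_scheme \<Rightarrow> 'a set gorder" where
  "pri_lattice R = \<lparr>carrier = principal_right_ideals R, eq = (=), le = (\<subseteq>)\<rparr>"

definition complements :: "('a, 'm) gorder_scheme \<Rightarrow> 'a \<Rightarrow> 'a \<Rightarrow> bool" where
  "complements L a c \<longleftrightarrow> a \<in> carrier L \<and> c \<in> carrier L \<and>
     a \<squnion>\<^bsub>L\<^esub> c = \<top>\<^bsub>L\<^esub> \<and> a \<sqinter>\<^bsub>L\<^esub> c = \<bottom>\<^bsub>L\<^esub>"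

definition perspective :: "('a, 'm) gorder_scheme \<Rightarrow> 'a \<Rightarrow> 'a \<Rightarrow> bool" where
  "perspective L a b \<longleftrightarrow> (\<exists>c. complements L a c \<and> complements L b c)"

(* Since Suc d is nonzero, the cardinality condition makes the chain C finite. *)
definition has_height :: "('a, 'm) gorder_scheme \<Rightarrow> 'a \<Rightarrow> nat \<Rightarrow> bool" where
  "has_height L a d \<longleftrightarrow>
     (\<exists>C. pred_on.maxchain (at_least_at_most L \<bottom>\<^bsub>L\<^esub> a) (le L) C \<and> card C = Suc d)"

definition finite_height :: "('a, 'm) gorder_scheme \<Rightarrow> 'a \<Rightarrow> bool" where
  "finite_height L a \<longleftrightarrow> (\<exists>d. has_height L a d)"

(* The module type of HOL-Algebra requires commutative scalars, so isomorphism of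
   right ideals as right R-modules is spelled out. *)
definition right_module_iso ::
  "('a, 'm) ring_scheme \<Rightarrow> 'a set \<Rightarrow> 'a set \<Rightarrow> ('a \<Rightarrow> 'a) \<Rightarrow> bool" where
  "right_module_iso R A B f \<longleftrightarrow> bij_betw f A B \<and>
     (\<forall>x\<in>A. \<forall>y\<in>A. f (x \<oplus>\<^bsub>R\<^esub> y) = f x \<oplus>\<^bsub>R\<^esub> f y) \<and>
     (\<forall>x\<in>A. \<forall>r\<in>carrier R. f (x \<otimes>\<^bsub>R\<^esub> r) = f x \<otimes>\<^bsub>R\<^esub> r)"

definition right_module_isomorphic ::
  "('a, 'm) ring_scheme \<Rightarrow> 'a set \<Rightarrow> 'a set \<Rightarrow> bool" where
  "right_module_isomorphic R A B \<longleftrightarrow> (\<exists>f. right_module_iso R A B f)"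

end

theory Submission
  imports Defs
begin

text \<open>
  In \<open>L(R)\<close> a complement of \<open>A\<close> is a principal right ideal \<open>C\<close> with \<open>R = A \<oplus> C\<close>. If \<open>C\<close> is
  a common complement of \<open>A\<close> and \<open>B\<close>, then both are isomorphic to \<open>R/C\<close>; concretely, the projection
  along \<open>C\<close> maps \<open>A\<close> onto \<open>B\<close> (\<open>common_complement_imp_isomorphic\<close>).

  Conversely, let \<open>A \<cong> B\<close> and put \<open>D = A \<inter> B\<close>. Regularity gives splittings \<open>A = D \<oplus> A'\<close> and
  \<open>B = D \<oplus> B'\<close>. If \<open>D\<close> can be cancelled from \<open>D \<oplus> A' \<cong> D \<oplus> B'\<close>, there is an isomorphism
  \<open>f : A' \<rightarrow> B'\<close>, and as \<open>A'\<close> and \<open>B'\<close> are independent its graph \<open>G = {x + f x | x \<in> A'}\<close> is a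
  common complement of \<open>A'\<close> and \<open>B'\<close> in \<open>A' \<oplus> B'\<close>. Then \<open>G\<close> is a common complement of \<open>A\<close> and \<open>B\<close>
  in \<open>A + B = D \<oplus> A' \<oplus> B'\<close>, and \<open>G \<oplus> E\<close> is one in \<open>R\<close>, where \<open>R = (A + B) \<oplus> E\<close>.

  Cancellation is where the finite height is needed. Relative complements along a finite maximal chain
  below \<open>D\<close> write \<open>D\<close> as a direct sum of finitely many simple right ideals
  (\<open>finite_height_imp_finite_semisimple\<close>), and these are cancelled one at a time. A simple summand is
  cancelled by \<open>cancel_simple\<close>: if \<open>S \<oplus> U = T \<oplus> V\<close> with \<open>S \<cong> T\<close> simple, then \<open>U\<close> and \<open>V\<close> are
  maximal submodules, and \<open>S\<close>, \<open>T\<close> or the graph of an isomorphism \<open>S \<rightarrow> T\<close> complements both of them.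
\<close>

section \<open>Right ideals and direct sums\<close>

no_notation Sum_Type.Plus (infixr \<open><+>\<close> 65)

context ring
begin

definition right_ideal :: "'a set \<Rightarrow> bool" where
  "right_ideal I \<longleftrightarrow> I \<subseteq> carrier R \<and> \<zero> \<in> I \<and> (\<forall>x\<in>I. \<forall>y\<in>I. x \<oplus> y \<in> I) \<and>
     (\<forall>x\<in>I. \<forall>r\<in>carrier R. x \<otimes> r \<in> I)"

definition direct_sum :: "'a set \<Rightarrow> 'a set \<Rightarrow> 'a set \<Rightarrow> bool" where
  "direct_sum I J M \<longleftrightarrow> right_ideal I \<and> right_ideal J \<and> I <+> J = M \<and> I \<inter> J = {\<zero>}"

lemma right_idealD:
  assumes "right_ideal I"
  shows "I \<subseteq> carrier R" "x \<in> I \<Longrightarrow> x \<in> carrier R" "\<zero> \<in> I"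
    "x \<in> I \<Longrightarrow> y \<in> I \<Longrightarrow> x \<oplus> y \<in> I"
    "x \<in> I \<Longrightarrow> r \<in> carrier R \<Longrightarrow> x \<otimes> r \<in> I"
    "x \<in> I \<Longrightarrow> \<ominus> x \<in> I" "x \<in> I \<Longrightarrow> y \<in> I \<Longrightarrow> x \<ominus> y \<in> I"
proof -
  have neg: "\<ominus> x \<in> I" if "x \<in> I" for x
  proof -
    have "x \<otimes> (\<ominus> \<one>) = \<ominus> x"
      using that assms by (auto simp: right_ideal_def r_minus)
    then show ?thesis
      using that assms unfolding right_ideal_def by (metis a_inv_closed one_closed)
  qed
  then show "x \<in> I \<Longrightarrow> \<ominus> x \<in> I" "x \<in> I \<Longrightarrow> y \<in> I \<Longrightarrow> x \<ominus> y \<in> I"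
    using assms by (auto simp: right_ideal_def minus_eq)
qed (use assms in \<open>auto simp: right_ideal_def\<close>)

lemma add_diff_cancel:
  assumes "x \<in> carrier R" "y \<in> carrier R"
  shows "(x \<oplus> y) \<ominus> x = y" "(x \<oplus> y) \<ominus> y = x"
  using assms a_comm[of "x \<oplus> y" "\<ominus> x"] by (simp_all add: minus_eq r_neg1 a_assoc r_neg)

lemma diff_simps:
  assumes "x \<in> carrier R" "y \<in> carrier R"
  shows "x \<ominus> x = \<zero>" "x \<ominus> \<zero> = x" "(x \<ominus> y) \<oplus> y = x" "y \<oplus> (x \<ominus> y) = x"
  using assms a_comm[of y "x \<ominus> y"] by (simp_all add: minus_eq a_assoc r_neg l_neg)

lemma set_add_iff: "x \<in> I <+> J \<longleftrightarrow> (\<exists>i\<in>I. \<exists>j\<in>J. x = i \<oplus> j)"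
  by (auto simp: set_add_def')

lemma set_addI: "i \<in> I \<Longrightarrow> j \<in> J \<Longrightarrow> i \<oplus> j \<in> I <+> J"
  by (auto simp: set_add_iff)

lemma right_ideal_sum:
  assumes "right_ideal I" "right_ideal J"
  shows "right_ideal (I <+> J)"
proof -
  note I = right_idealD[OF assms(1)] and J = right_idealD[OF assms(2)]
  show ?thesis
    unfolding right_ideal_def
  proof (intro conjI ballI)
    show "I <+> J \<subseteq> carrier R" using I(1) J(1) by (rule set_add_closed)
    show "\<zero> \<in> I <+> J" using set_addI[OF I(3) J(3)] by simp
  next
    fix x y assume "x \<in> I <+> J" "y \<in> I <+> J"
    then obtain a b c d where "a \<in> I" "b \<in> J" "x = a \<oplus> b" "c \<in> I" "d \<in> J" "y = c \<oplus> d"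
      by (auto simp: set_add_iff)
    moreover from this have "x \<oplus> y = (a \<oplus> c) \<oplus> (b \<oplus> d)"
      using I(2) J(2) by (simp add: a_ac)
    ultimately show "x \<oplus> y \<in> I <+> J" by (simp add: set_addI I(4) J(4))
  next
    fix x r assume "x \<in> I <+> J" "r \<in> carrier R"
    then obtain a b where "a \<in> I" "b \<in> J" "x = a \<oplus> b" by (auto simp: set_add_iff)
    with \<open>r \<in> carrier R\<close> show "x \<otimes> r \<in> I <+> J"
      by (simp add: l_distr I(2) J(2) set_addI I(5) J(5))
  qed
qed

lemma right_ideal_sum_upper:
  assumes "right_ideal I" "right_ideal J"
  shows "I \<subseteq> I <+> J" "J \<subseteq> I <+> J"
proof -
  note I = right_idealD[OF assms(1)] and J = right_idealD[OF assms(2)]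
  show "I \<subseteq> I <+> J" using set_addI[OF _ J(3), of _ I] I(2) by fastforce
  show "J \<subseteq> I <+> J" using set_addI[OF I(3), of _ J] J(2) by fastforce
qed

lemma right_ideal_sum_least:
  "right_ideal K \<Longrightarrow> I \<subseteq> K \<Longrightarrow> J \<subseteq> K \<Longrightarrow> I <+> J \<subseteq> K"
  using right_idealD(4)[of K] unfolding set_add_def' by blast

lemma sum_assoc:
  assumes "right_ideal I" "right_ideal J" "right_ideal K"
  shows "(I <+> J) <+> K = I <+> (J <+> K)"
  using assms[THEN right_idealD(1)] unfolding set_add_def
  by (intro group.set_mult_assoc) (auto simp: a_group)

lemma direct_sumD:
  assumes "direct_sum I J M"
  shows "right_ideal I" "right_ideal J" "I <+> J = M" "I \<inter> J = {\<zero>}" "right_ideal M"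
    "I \<subseteq> M" "J \<subseteq> M"
  using assms right_ideal_sum[of I J] right_ideal_sum_upper[of I J]
  unfolding direct_sum_def by blast+

lemma direct_sumI:
  assumes "right_ideal I" "right_ideal J" "I <+> J = M"
    and "\<And>x. x \<in> I \<Longrightarrow> x \<in> J \<Longrightarrow> x = \<zero>"
  shows "direct_sum I J M"
  using assms right_idealD(3)[OF assms(1)] right_idealD(3)[OF assms(2)]
  unfolding direct_sum_def by blast

lemma direct_sum_commute: "direct_sum I J M \<Longrightarrow> direct_sum J I M"
  using set_add_comm[OF right_idealD(1) right_idealD(1), of I J]
  unfolding direct_sum_def by blast

text \<open>
  Rebracketing \<open>(I \<oplus> J) \<oplus> L\<close> as \<open>I \<oplus> (J \<oplus> L)\<close>. Together with commutativity this does all the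
  rearranging of direct sums below.
\<close>

lemma direct_sum_assoc:
  assumes "direct_sum I J K" "direct_sum K L M"
  shows "direct_sum J L (J <+> L)" "direct_sum I (J <+> L) M"
proof -
  note IJ = direct_sumD[OF assms(1)] and KL = direct_sumD[OF assms(2)]
  note I = right_idealD[OF IJ(1)] and J = right_idealD[OF IJ(2)] and L = right_idealD[OF KL(2)]
  note K = right_idealD[OF KL(1)]
  show "direct_sum J L (J <+> L)"
    using IJ KL by (intro direct_sumI) auto
  show "direct_sum I (J <+> L) M"
  proof (rule direct_sumI)
    show "I <+> (J <+> L) = M" using sum_assoc[OF IJ(1,2) KL(2)] IJ(3) KL(3) by simp
  next
    fix x assume x: "x \<in> I" "x \<in> J <+> L"
    then obtain j l where jl: "j \<in> J" "l \<in> L" "x = j \<oplus> l" by (auto simp: set_add_iff)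
    have "x \<ominus> j = l" using jl J(2) L(2) by (simp add: add_diff_cancel)
    moreover have "x \<ominus> j \<in> K" using x jl IJ(6,7) K(7) by blast
    ultimately have "l = \<zero>" using jl KL(4) by auto
    then show "x = \<zero>" using jl x J(2) IJ(4) by auto
  qed (use IJ KL right_ideal_sum in auto)
qed

lemma direct_sum_unique_component:
  assumes "direct_sum I J M" "x \<in> M"
  shows "\<exists>!y. y \<in> I \<and> x \<ominus> y \<in> J"
proof -
  note IJ = direct_sumD[OF assms(1)]
  note I = right_idealD[OF IJ(1)] and J = right_idealD[OF IJ(2)]
  obtain i j where ij: "i \<in> I" "j \<in> J" "x = i \<oplus> j"
    using assms(2) IJ(3) by (auto simp: set_add_iff)
  show ?thesis
  proof (rule ex1I)
    have "x \<ominus> i = j" using ij I(2) J(2) by (simp add: add_diff_cancel)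
    then show "i \<in> I \<and> x \<ominus> i \<in> J" using ij by simp
  next
    fix y assume y: "y \<in> I \<and> x \<ominus> y \<in> J"
    have c: "y \<in> carrier R" "i \<in> carrier R" "j \<in> carrier R" using y ij I J by auto
    have "x \<ominus> y = (i \<ominus> y) \<oplus> j"
      using c ij(3) by (simp add: minus_eq a_ac)
    then have "(x \<ominus> y) \<ominus> j = i \<ominus> y"
      using c by (simp add: add_diff_cancel)
    then have "i \<ominus> y \<in> I \<inter> J" using J(7)[of "x \<ominus> y" j] I(7)[of i y] y ij by simp
    then show "y = i" using IJ(4) c by (simp add: r_right_minus_eq)
  qed
qed

section \<open>Isomorphisms of right ideals\<close>

text \<open>
  Both \<open>A\<close> and \<open>B\<close> represent \<open>M/C\<close>. The isomorphism sends \<open>x \<in> A\<close> to the unique element of \<open>B\<close>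
  congruent to \<open>x\<close> modulo \<open>C\<close>; its inverse has the same description with \<open>A\<close> and \<open>B\<close> exchanged.
\<close>

lemma common_complement_imp_isomorphic:
  assumes "direct_sum A C M" "direct_sum B C M"
  shows "right_module_isomorphic R A B"
proof -
  note A = direct_sumD[OF assms(1)] and B = direct_sumD[OF assms(2)]
  note a = right_idealD[OF A(1)] and b = right_idealD[OF B(1)] and c = right_idealD[OF A(2)]
  define f where "f x = (THE y. y \<in> B \<and> x \<ominus> y \<in> C)" for x
  define g where "g y = (THE x. x \<in> A \<and> y \<ominus> x \<in> C)" for y
  have f: "f x \<in> B \<and> x \<ominus> f x \<in> C" if "x \<in> A" for x
    unfolding f_def using that A(6)
    by (intro theI'[OF direct_sum_unique_component[OF assms(2)]]) (simp add: subsetD)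
  have g: "g y \<in> A \<and> y \<ominus> g y \<in> C" if "y \<in> B" for y
    unfolding g_def using that B(6)
    by (intro theI'[OF direct_sum_unique_component[OF assms(1)]]) (simp add: subsetD)
  have f_eq: "f x = y" if "x \<in> A" "y \<in> B" "x \<ominus> y \<in> C" for x y
    unfolding f_def using that A(6)
    by (intro the1_equality[OF direct_sum_unique_component[OF assms(2)]]) (simp_all add: subsetD)
  have g_eq: "g y = x" if "y \<in> B" "x \<in> A" "y \<ominus> x \<in> C" for x y
    unfolding g_def using that B(6)
    by (intro the1_equality[OF direct_sum_unique_component[OF assms(1)]]) (simp_all add: subsetD)
  have sym: "y \<ominus> x \<in> C" if "x \<ominus> y \<in> C" "x \<in> carrier R" "y \<in> carrier R" for x y
  proof -
    have "\<ominus> (x \<ominus> y) = y \<ominus> x" using that by (simp add: minus_eq minus_add a_comm)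
    then show ?thesis using c(6)[OF that(1)] by simp
  qed
  have "bij_betw f A B"
  proof (rule bij_betw_byWitness[where f' = g])
    show "\<forall>x\<in>A. g (f x) = x"
      using f by (simp add: g_eq sym[of _ "f _"] a(2) b(2))
    show "\<forall>y\<in>B. f (g y) = y"
      using g by (simp add: f_eq sym[of _ "g _"] a(2) b(2))
    show "f ` A \<subseteq> B" "g ` B \<subseteq> A" using f g by (simp_all add: image_subset_iff)
  qed
  moreover have "f (x \<oplus> y) = f x \<oplus> f y" if "x \<in> A" "y \<in> A" for x y
  proof (rule f_eq)
    show "x \<oplus> y \<in> A" "f x \<oplus> f y \<in> B" using that f by (simp_all add: a(4) b(4))
    have "(x \<oplus> y) \<ominus> (f x \<oplus> f y) = (x \<ominus> f x) \<oplus> (y \<ominus> f y)"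
      using that f a(2) b(2) by (simp add: minus_eq minus_add a_ac)
    then show "(x \<oplus> y) \<ominus> (f x \<oplus> f y) \<in> C" using that f c(4) by simp
  qed
  moreover have "f (x \<otimes> r) = f x \<otimes> r" if "x \<in> A" "r \<in> carrier R" for x r
  proof (rule f_eq)
    show "x \<otimes> r \<in> A" "f x \<otimes> r \<in> B" using that f by (simp_all add: a(5) b(5))
    have "(x \<otimes> r) \<ominus> (f x \<otimes> r) = (x \<ominus> f x) \<otimes> r"
      using that f a(2) b(2) by (simp add: minus_eq l_distr l_minus)
    then show "(x \<otimes> r) \<ominus> (f x \<otimes> r) \<in> C" using that f c(5) by simp
  qed
  ultimately show ?thesis
    unfolding right_module_isomorphic_def right_module_iso_def by blast
qed

lemma right_module_isomorphic_sym:
  assumes "right_ideal A" "right_module_isomorphic R A B"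
  shows "right_module_isomorphic R B A"
proof -
  note a = right_idealD[OF assms(1)]
  obtain f where f: "bij_betw f A B" "\<And>x y. x \<in> A \<Longrightarrow> y \<in> A \<Longrightarrow> f (x \<oplus> y) = f x \<oplus> f y"
    "\<And>x r. x \<in> A \<Longrightarrow> r \<in> carrier R \<Longrightarrow> f (x \<otimes> r) = f x \<otimes> r"
    using assms(2) unfolding right_module_isomorphic_def right_module_iso_def by blast
  define g where "g = the_inv_into A f"
  have gf: "g (f x) = x" if "x \<in> A" for x
    using f(1) that unfolding g_def bij_betw_def by (simp add: the_inv_into_f_f)
  have surj: "\<exists>x\<in>A. y = f x" if "y \<in> B" for y using f(1) that unfolding bij_betw_def by blast
  have "bij_betw g B A" unfolding g_def using f(1) by (rule bij_betw_the_inv_into)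
  moreover have "g (x \<oplus> y) = g x \<oplus> g y" if xy: "x \<in> B" "y \<in> B" for x y
    using surj[OF xy(1)] surj[OF xy(2)] by (auto simp: gf a(4) simp flip: f(2))
  moreover have "g (x \<otimes> r) = g x \<otimes> r" if xr: "x \<in> B" "r \<in> carrier R" for x r
    using surj[OF xr(1)] xr(2) by (auto simp: gf a(5) simp flip: f(3))
  ultimately show ?thesis
    unfolding right_module_isomorphic_def right_module_iso_def by blast
qed

lemma right_module_isomorphic_trans:
  assumes "right_module_isomorphic R A B" "right_module_isomorphic R B C"
  shows "right_module_isomorphic R A C"
proof -
  obtain f g where fg: "right_module_iso R A B f" "right_module_iso R B C g"
    using assms unfolding right_module_isomorphic_def by blast
  then have "f x \<in> B" if "x \<in> A" for x
    using that by (auto simp: right_module_iso_def bij_betw_def)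
  then have "right_module_iso R A C (g \<circ> f)"
    using fg bij_betw_trans[of f A B g C] by (auto simp: right_module_iso_def)
  then show ?thesis unfolding right_module_isomorphic_def by blast
qed

lemma iso_zero:
  assumes "right_ideal A" "right_ideal B" "right_module_iso R A B f"
  shows "f \<zero> = \<zero>"
proof -
  have z: "\<zero> \<in> A" using assms(1) by (rule right_idealD)
  then have "f \<zero> \<in> carrier R"
    using assms(3) right_idealD(2)[OF assms(2)] by (auto simp: right_module_iso_def bij_betw_def)
  moreover have "f (\<zero> \<otimes> \<zero>) = f \<zero> \<otimes> \<zero>" using assms(3) z zero_closed
    unfolding right_module_iso_def by blast
  ultimately show ?thesis by simp
qed

lemma iso_restrict:
  assumes "right_module_iso R A B f" "I \<subseteq> A"
  shows "right_module_iso R I (f ` I) f"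
  using assms unfolding right_module_iso_def bij_betw_def
  by (auto intro: inj_on_subset simp: subset_iff)

lemma right_ideal_image:
  assumes "right_ideal A" "right_ideal B" "right_module_iso R A B f" "right_ideal I" "I \<subseteq> A"
  shows "right_ideal (f ` I)"
proof -
  note i = right_idealD[OF assms(4)]
  note f = assms(3)[unfolded right_module_iso_def]
  have "f ` I \<subseteq> carrier R"
    using f assms(5) right_idealD(1)[OF assms(2)] by (auto simp: bij_betw_def)
  moreover have "\<zero> \<in> f ` I" using iso_zero[OF assms(1-3)] i(3) by force
  moreover have "f x \<oplus> f y \<in> f ` I" if "x \<in> I" "y \<in> I" for x y
    using that i(4) f assms(5) by (intro image_eqI[of _ _ "x \<oplus> y"]) (simp_all add: subset_iff)
  moreover have "f x \<otimes> r \<in> f ` I" if "x \<in> I" "r \<in> carrier R" for x r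
    using that i(5) f assms(5) by (intro image_eqI[of _ _ "x \<otimes> r"]) (simp_all add: subset_iff)
  ultimately show ?thesis unfolding right_ideal_def by blast
qed

lemma direct_sum_image:
  assumes "right_ideal B" "right_module_iso R A B f" "direct_sum I J A"
  shows "direct_sum (f ` I) (f ` J) B"
proof -
  note IJ = direct_sumD[OF assms(3)]
  note f = assms(2)[unfolded right_module_iso_def]
  show ?thesis
  proof (rule direct_sumI)
    show "f ` I <+> f ` J = B"
    proof -
      have "f ` I <+> f ` J = f ` (I <+> J)"
      proof -
        have "f (i \<oplus> j) = f i \<oplus> f j" if "i \<in> I" "j \<in> J" for i j
          using that IJ(6,7) f by (simp add: subset_iff)
        then show ?thesis unfolding set_add_def' by (simp add: image_UN)
      qed
      then show ?thesis using f IJ(3) by (auto simp: bij_betw_def)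
    qed
  next
    fix x assume "x \<in> f ` I" "x \<in> f ` J"
    then obtain i j where ij: "i \<in> I" "j \<in> J" "x = f i" "f i = f j" by auto
    then have "i = j" using f IJ(6,7) by (auto simp: bij_betw_def inj_on_def)
    then have "i = \<zero>" using ij IJ(4) by auto
    then show "x = \<zero>" using ij iso_zero[OF IJ(5) assms(1,2)] by simp
  qed (use right_ideal_image[OF IJ(5) assms(1,2)] IJ in auto)
qed

section \<open>Graphs as common complements\<close>

definition graph :: "('a \<Rightarrow> 'a) \<Rightarrow> 'a set \<Rightarrow> 'a set" where
  "graph f A = (\<lambda>x. x \<oplus> f x) ` A"

lemma right_ideal_graph:
  assumes "right_ideal A" "right_ideal B" "right_module_iso R A B f"
  shows "right_ideal (graph f A)"
proof -
  note a = right_idealD[OF assms(1)] and b = right_idealD[OF assms(2)]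
  note f = assms(3)[unfolded right_module_iso_def]
  have fB: "f x \<in> B" if "x \<in> A" for x using f that by (auto simp: bij_betw_def)
  show ?thesis
    unfolding right_ideal_def
  proof (intro conjI ballI)
    show "graph f A \<subseteq> carrier R" using a(2) b(2) fB by (auto simp: graph_def)
    show "\<zero> \<in> graph f A" using a(3) iso_zero[OF assms] by (force simp: graph_def)
  next
    fix x y assume "x \<in> graph f A" "y \<in> graph f A"
    then obtain u v where uv: "u \<in> A" "v \<in> A" "x = u \<oplus> f u" "y = v \<oplus> f v"
      by (auto simp: graph_def)
    then have "x \<oplus> y = (u \<oplus> v) \<oplus> f (u \<oplus> v)"
      using f a(2) b(2) fB by (simp add: a_ac)
    then show "x \<oplus> y \<in> graph f A" using uv a(4) by (auto simp: graph_def)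
  next
    fix x r assume "x \<in> graph f A" and r: "r \<in> carrier R"
    then obtain u where u: "u \<in> A" "x = u \<oplus> f u" by (auto simp: graph_def)
    then have "x \<otimes> r = u \<otimes> r \<oplus> f (u \<otimes> r)"
      using f a(2) b(2) fB r by (simp add: l_distr)
    then show "x \<otimes> r \<in> graph f A" using u a(5) r by (auto simp: graph_def)
  qed
qed

text \<open>
  Modulo its graph, an isomorphism \<open>f : A \<rightarrow> B\<close> identifies \<open>x\<close> with \<open>- f x\<close>. So the graph together with
  either of \<open>A\<close> and \<open>B\<close> generates the other, and it meets each of them trivially because \<open>f\<close> is
  injective and \<open>A \<inter> B = 0\<close>.
\<close>

lemma direct_sum_graph:
  assumes "direct_sum A B M" "right_module_iso R A B f"
  shows "direct_sum A (graph f A) M" "direct_sum B (graph f A) M"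
proof -
  note AB = direct_sumD[OF assms(1)]
  note a = right_idealD[OF AB(1)] and b = right_idealD[OF AB(2)]
  note f = assms(2)[unfolded right_module_iso_def]
  have fB: "f x \<in> B" if "x \<in> A" for x using f that by (auto simp: bij_betw_def)
  have G: "right_ideal (graph f A)" using right_ideal_graph AB(1,2) assms(2) by blast
  have gM: "graph f A \<subseteq> M" using AB(3) set_addI[OF _ fB] by (auto simp: graph_def)
  have fz: "f \<zero> = \<zero>" using iso_zero AB(1,2) assms(2) by blast
  have sA: "right_ideal (A <+> graph f A)" and sB: "right_ideal (B <+> graph f A)"
    using AB G right_ideal_sum by auto
  note uA = right_ideal_sum_upper[OF AB(1) G] and uB = right_ideal_sum_upper[OF AB(2) G]
  have "B \<subseteq> A <+> graph f A"
  proof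
    fix y assume "y \<in> B"
    then obtain x where x: "x \<in> A" "y = f x" using f by (auto simp: bij_betw_def)
    then have "y = (x \<oplus> f x) \<ominus> x"
      using a(2) b(2) fB by (simp add: add_diff_cancel)
    moreover have "x \<oplus> f x \<in> graph f A" using x by (auto simp: graph_def)
    ultimately show "y \<in> A <+> graph f A"
      using uA x right_idealD(7)[OF sA, of "x \<oplus> f x" x] by blast
  qed
  then have A_sum: "A <+> graph f A = M"
    using right_ideal_sum_least[OF sA uA(1)] right_ideal_sum_least[OF AB(5,6) gM] AB(3) by blast
  have "A \<subseteq> B <+> graph f A"
  proof
    fix x assume x: "x \<in> A"
    then have "x = (x \<oplus> f x) \<ominus> f x"
      using a(2) b(2) fB by (simp add: add_diff_cancel)
    moreover have "x \<oplus> f x \<in> graph f A" using x by (auto simp: graph_def)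
    ultimately show "x \<in> B <+> graph f A"
      using uB fB[OF x] right_idealD(7)[OF sB, of "x \<oplus> f x" "f x"] by (metis in_mono)
  qed
  then have B_sum: "B <+> graph f A = M"
    using right_ideal_sum_least[OF sB _ uB(1), of A] right_ideal_sum_least[OF AB(5,7) gM] AB(3)
    by blast
  show "direct_sum A (graph f A) M"
  proof (rule direct_sumI[OF AB(1) G A_sum])
    fix z assume z: "z \<in> A" "z \<in> graph f A"
    then obtain x where x: "x \<in> A" "z = x \<oplus> f x" by (auto simp: graph_def)
    have "z \<ominus> x = f x" using x a(2) b(2) fB by (simp add: add_diff_cancel)
    then have "f x = \<zero>" using a(7)[OF z(1) x(1)] fB[OF x(1)] AB(4) by auto
    moreover from this have "x = \<zero>"
      using f fz x a(3) by (auto simp: bij_betw_def inj_on_def)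
    ultimately show "z = \<zero>" using x by simp
  qed
  show "direct_sum B (graph f A) M"
  proof (rule direct_sumI[OF AB(2) G B_sum])
    fix z assume z: "z \<in> B" "z \<in> graph f A"
    then obtain x where x: "x \<in> A" "z = x \<oplus> f x" by (auto simp: graph_def)
    have "z \<ominus> f x = x" using x a(2) b(2) fB by (simp add: add_diff_cancel)
    then have "x = \<zero>" using b(7)[OF z(1) fB[OF x(1)]] x(1) AB(4) by auto
    then show "z = \<zero>" using x fz by simp
  qed
qed

text \<open>
  With \<open>D = A \<inter> B\<close>, the sum \<open>A + B\<close> is \<open>D \<oplus> (A' \<oplus> B')\<close>, and inside the second summand the graph can
  replace \<open>B'\<close> or \<open>A'\<close>. Regrouping \<open>D\<close> with \<open>A'\<close>, or with \<open>B'\<close>, gives the two claims.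
\<close>

lemma graph_common_complement:
  assumes A: "direct_sum (A \<inter> B) A' A" and B: "direct_sum (A \<inter> B) B' B"
    and f: "right_module_iso R A' B' f"
  shows "direct_sum A (graph f A') (A <+> B)" "direct_sum B (graph f A') (A <+> B)"
proof -
  note a = direct_sumD[OF A] and b = direct_sumD[OF B]
  have AB': "direct_sum A B' (A <+> B)"
  proof (rule direct_sumI[OF a(5) b(2)])
    note s = right_ideal_sum[OF a(5) b(2)] and u = right_ideal_sum_upper[OF a(5) b(2)]
    have "B \<subseteq> A <+> B'" using right_ideal_sum_least[OF s, of "A \<inter> B" B'] u b(3) by blast
    then have "A <+> B \<subseteq> A <+> B'" using right_ideal_sum_least[OF s u(1)] by blast
    moreover have "A <+> B' \<subseteq> A <+> B"
      using right_ideal_sum_least[OF right_ideal_sum[OF a(5) b(5)], of A B']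
        right_ideal_sum_upper[OF a(5) b(5)] b(7) by blast
    ultimately show "A <+> B' = A <+> B" by blast
  next
    fix x assume "x \<in> A" "x \<in> B'"
    then show "x = \<zero>" using b(4,7) by blast
  qed
  note split = direct_sum_assoc[OF A AB']
  note g = direct_sum_graph[OF split(1) f]
  have "direct_sum (graph f A') (A' <+> A \<inter> B) (A <+> B)"
    using direct_sum_assoc(2)[OF direct_sum_commute[OF g(1)] direct_sum_commute[OF split(2)]] .
  then show "direct_sum A (graph f A') (A <+> B)"
    using direct_sumD(3)[OF direct_sum_commute[OF A]] direct_sum_commute by simp
  have "direct_sum (graph f A') (B' <+> A \<inter> B) (A <+> B)"
    using direct_sum_assoc(2)[OF direct_sum_commute[OF g(2)] direct_sum_commute[OF split(2)]] .
  then show "direct_sum B (graph f A') (A <+> B)"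
    using direct_sumD(3)[OF direct_sum_commute[OF B]] direct_sum_commute by simp
qed

section \<open>Cancellation of semisimple summands\<close>

text \<open>
  Simplicity of \<open>S\<close> as a module, in the form that every nonzero element generates \<open>S\<close>. This form passes
  along isomorphisms without reference to submodules.
\<close>

definition simple_right_ideal :: "'a set \<Rightarrow> bool" where
  "simple_right_ideal S \<longleftrightarrow> right_ideal S \<and> S \<noteq> {\<zero>} \<and>
     (\<forall>x\<in>S. x \<noteq> \<zero> \<longrightarrow> S \<subseteq> x <# carrier R)"

lemma simple_right_ideal_minimal:
  assumes "simple_right_ideal S" "right_ideal I" "x \<in> S" "x \<in> I" "x \<noteq> \<zero>"
  shows "S \<subseteq> I"
proof -
  have "S \<subseteq> x <# carrier R" using assms by (auto simp: simple_right_ideal_def)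
  also have "\<dots> \<subseteq> I" using assms(2,4) by (auto simp: l_coset_def right_ideal_def)
  finally show ?thesis .
qed

lemma simple_right_ideal_iso:
  assumes "simple_right_ideal S" "right_ideal T" "right_module_isomorphic R S T"
  shows "simple_right_ideal T"
proof -
  obtain f where iso: "right_module_iso R S T f"
    using assms(3) by (auto simp: right_module_isomorphic_def)
  note f = iso[unfolded right_module_iso_def]
  have S: "right_ideal S" using assms(1) by (simp add: simple_right_ideal_def)
  note s = right_idealD[OF S]
  have fz: "f \<zero> = \<zero>" using iso_zero[OF S assms(2) iso] .
  have "T \<noteq> {\<zero>}"
  proof
    assume "T = {\<zero>}"
    then have "f x = f \<zero>" if "x \<in> S" for x using f fz that by (auto simp: bij_betw_def)
    then have "S \<subseteq> {\<zero>}" using f s(3) inj_onD[of f S] unfolding bij_betw_def by blast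
    then show False using assms(1) s(3) by (auto simp: simple_right_ideal_def)
  qed
  moreover have "T \<subseteq> y <# carrier R" if y: "y \<in> T" "y \<noteq> \<zero>" for y
  proof
    fix z assume "z \<in> T"
    then obtain x w where xw: "x \<in> S" "w \<in> S" "y = f x" "z = f w"
      using f y by (auto simp: bij_betw_def)
    then have "w \<in> x <# carrier R" using assms(1) y fz by (auto simp: simple_right_ideal_def)
    then obtain r where "r \<in> carrier R" "w = x \<otimes> r" by (auto simp: l_coset_def)
    then show "z \<in> y <# carrier R" using xw f by (auto simp: l_coset_def)
  qed
  ultimately show ?thesis using assms(2) by (auto simp: simple_right_ideal_def)
qed

text \<open>
  The quotient of \<open>M\<close> by \<open>V\<close> is isomorphic to the simple \<open>T\<close>, so \<open>V\<close> is a maximal submodule, and any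
  simple \<open>Z\<close> not contained in it is a complement.
\<close>

lemma simple_complement:
  assumes "simple_right_ideal T" "direct_sum T V M"
    and "simple_right_ideal Z" "Z \<subseteq> M" "\<not> Z \<subseteq> V"
  shows "direct_sum Z V M"
proof -
  note TV = direct_sumD[OF assms(2)]
  have Z: "right_ideal Z" using assms(3) by (simp add: simple_right_ideal_def)
  have ZV: "right_ideal (Z <+> V)" using right_ideal_sum[OF Z TV(2)] .
  note u = right_ideal_sum_upper[OF Z TV(2)]
  obtain z where z: "z \<in> Z" "z \<notin> V" using assms(5) by auto
  then obtain t y where ty: "t \<in> T" "y \<in> V" "z = t \<oplus> y"
    using assms(4) TV(3) set_add_iff[of z T V] by blast
  have c: "t \<in> carrier R" "y \<in> carrier R"
    using ty right_idealD(2)[OF TV(1)] right_idealD(2)[OF TV(2)] by auto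
  have "t = z \<ominus> y" using ty c by (simp add: add_diff_cancel)
  moreover have "z \<ominus> y \<in> Z <+> V" using z ty u right_idealD(7)[OF ZV, of z y] by blast
  moreover have "t \<noteq> \<zero>" using ty c z by auto
  ultimately have "T \<subseteq> Z <+> V"
    using simple_right_ideal_minimal[OF assms(1) ZV] ty by blast
  then have "Z <+> V = M"
    using right_ideal_sum_least[OF ZV _ u(2), of T] right_ideal_sum_least[OF TV(5) assms(4) TV(7)]
      TV(3) by blast
  then show ?thesis
    using simple_right_ideal_minimal[OF assms(3) TV(2)] assms(5) Z TV(2)
    by (intro direct_sumI) auto
qed

text \<open>
  It suffices to find one simple \<open>Z\<close> contained in neither of the maximal submodules \<open>U\<close> and \<open>V\<close> of \<open>M\<close>:
  it is a common complement. Either \<open>S\<close> or \<open>T\<close> will do, unless \<open>S \<subseteq> V\<close> and \<open>T \<subseteq> U\<close>. In that case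
  \<open>S\<close> and \<open>T\<close> are independent, and the graph \<open>Z\<close> of an isomorphism from \<open>S\<close> to \<open>T\<close> works: if it lay in
  \<open>U\<close>, then so would \<open>S \<subseteq> Z + T\<close>, and likewise for \<open>V\<close>.
\<close>

lemma cancel_simple:
  assumes "simple_right_ideal S" "right_module_isomorphic R S T"
    and SU: "direct_sum S U M" and TV: "direct_sum T V M"
  shows "right_module_isomorphic R U V"
proof -
  note su = direct_sumD[OF SU] and tv = direct_sumD[OF TV]
  have T: "simple_right_ideal T" using simple_right_ideal_iso[OF assms(1) tv(1) assms(2)] .
  have iso: "right_module_isomorphic R U V" if "direct_sum Z U M" "direct_sum Z V M" for Z
    using that[THEN direct_sum_commute] by (rule common_complement_imp_isomorphic)
  consider "\<not> S \<subseteq> V" | "\<not> T \<subseteq> U" | "S \<subseteq> V" "T \<subseteq> U" by blast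
  then show ?thesis
  proof cases
    case 1
    then show ?thesis using iso SU simple_complement[OF T TV assms(1) su(6)] by blast
  next
    case 2
    then show ?thesis using iso TV simple_complement[OF assms(1) SU T tv(6)] by blast
  next
    case 3
    obtain f where f: "right_module_iso R S T f"
      using assms(2) by (auto simp: right_module_isomorphic_def)
    define Z where "Z = graph f S"
    have ST: "direct_sum S T (S <+> T)" using 3 su tv by (intro direct_sumI) auto
    note g = direct_sum_graph[OF ST f, folded Z_def]
    note gS = direct_sumD[OF g(1)] and gT = direct_sumD[OF g(2)]
    have "right_module_isomorphic R S Z"
      using common_complement_imp_isomorphic[OF ST direct_sum_commute[OF g(2)]] .
    then have Z: "simple_right_ideal Z" using simple_right_ideal_iso[OF assms(1)] gS(2) by blast
    have ZM: "Z \<subseteq> M" using gS(7) right_ideal_sum_least[OF su(5,6) tv(6)] by blast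
    have "\<not> Z \<subseteq> U"
    proof
      assume "Z \<subseteq> U"
      then have "S \<subseteq> U"
        using right_ideal_sum_least[OF su(2) 3(2)] gT(3) gS(6) by blast
      then show False using su assms(1) by (auto simp: simple_right_ideal_def)
    qed
    moreover have "\<not> Z \<subseteq> V"
    proof
      assume "Z \<subseteq> V"
      then have "T \<subseteq> V"
        using right_ideal_sum_least[OF tv(2) 3(1)] gS(3) gT(6) by blast
      then show False using tv T by (auto simp: simple_right_ideal_def)
    qed
    ultimately show ?thesis
      using iso simple_complement[OF assms(1) SU Z ZM] simple_complement[OF T TV Z ZM] by blast
  qed
qed

text \<open>
  Finite direct sums of simple right ideals, built up one summand at a time so that induction removes
  them one at a time.
\<close>

inductive finite_semisimple :: "'a set \<Rightarrow> bool" where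
  zero: "finite_semisimple {\<zero>}"
| add_simple: "simple_right_ideal S \<Longrightarrow> finite_semisimple D \<Longrightarrow> direct_sum S D M \<Longrightarrow>
    finite_semisimple M"

text \<open>
  For \<open>D = S \<oplus> D1\<close> and an isomorphism \<open>k : M \<rightarrow> N\<close>, the module \<open>N\<close> is both
  \<open>k S \<oplus> k (D1 \<oplus> A)\<close> and \<open>S \<oplus> (D1 \<oplus> B)\<close>. Cancelling the isomorphic simple summands \<open>k S\<close> and
  \<open>S\<close> leaves \<open>D1 \<oplus> A \<cong> D1 \<oplus> B\<close>.
\<close>

lemma cancel_finite_semisimple:
  assumes "finite_semisimple D"
    and "direct_sum D A M" "direct_sum D B N" "right_module_isomorphic R M N"
  shows "right_module_isomorphic R A B"
  using assms
proof (induction arbitrary: A B M N rule: finite_semisimple.induct)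
  case zero
  have unit: "{\<zero>} <+> K = K" if "right_ideal K" for K
    using right_idealD(2)[OF that] by (auto simp: set_add_iff)
  have "M = A" "N = B" using direct_sumD(2,3)[OF zero(1)] direct_sumD(2,3)[OF zero(2)] unit by auto
  then show ?case using zero(3) by simp
next
  case (add_simple S D1 D)
  note S = add_simple.hyps(1)
  obtain k where k: "right_module_iso R M N k"
    using add_simple.prems(3) by (auto simp: right_module_isomorphic_def)
  note a = direct_sum_assoc[OF add_simple.hyps(3) add_simple.prems(1)]
  note b = direct_sum_assoc[OF add_simple.hyps(3) add_simple.prems(2)]
  have k': "direct_sum (k ` S) (k ` (D1 <+> A)) N"
    using direct_sum_image[OF direct_sumD(5)[OF add_simple.prems(2)] k a(2)] .
  have isoS: "right_module_isomorphic R S (k ` S)"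
    and isoA: "right_module_isomorphic R (D1 <+> A) (k ` (D1 <+> A))"
    using iso_restrict[OF k] direct_sumD(6,7)[OF a(2)]
    unfolding right_module_isomorphic_def by blast+
  have "simple_right_ideal (k ` S)"
    using simple_right_ideal_iso[OF S direct_sumD(1)[OF k'] isoS] .
  moreover have "right_module_isomorphic R (k ` S) S"
    using right_module_isomorphic_sym[OF direct_sumD(1)[OF a(2)] isoS] .
  ultimately have "right_module_isomorphic R (k ` (D1 <+> A)) (D1 <+> B)"
    using cancel_simple[OF _ _ k' b(2)] by blast
  then have "right_module_isomorphic R (D1 <+> A) (D1 <+> B)"
    by (rule right_module_isomorphic_trans[OF isoA])
  then show ?case by (rule add_simple.IH[OF a(1) b(1)])
qed

end

section \<open>Principal right ideals of a regular ring\<close>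

lemma (in ring) right_ideal_principal: "a \<in> carrier R \<Longrightarrow> right_ideal (a <# carrier R)"
  unfolding right_ideal_def l_coset_def
  by (fastforce simp: m_assoc simp flip: r_distr intro: r_null[symmetric])

lemma (in ring) generator_mem_principal: "a \<in> carrier R \<Longrightarrow> a \<in> a <# carrier R"
  using r_one[of a] one_closed unfolding l_coset_def by blast

lemma (in ring) principal_right_idealI:
  "a \<in> carrier R \<Longrightarrow> a <# carrier R \<in> principal_right_ideals R"
  by (auto simp: principal_right_ideals_def)

lemma (in ring) principal_imp_right_ideal: "I \<in> principal_right_ideals R \<Longrightarrow> right_ideal I"
  using right_ideal_principal by (auto simp: principal_right_ideals_def)

text \<open>
  If \<open>e\<close> generates \<open>A\<close>, then \<open>e + f e\<close> generates the graph.
\<close>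

lemma (in ring) principal_graph:
  assumes "A \<in> principal_right_ideals R" "right_ideal B" "right_module_iso R A B f"
  shows "graph f A \<in> principal_right_ideals R"
proof -
  note f = assms(3)[unfolded right_module_iso_def]
  obtain e where e: "e \<in> carrier R" "A = e <# carrier R"
    using assms(1) by (auto simp: principal_right_ideals_def)
  have eA: "e \<in> A" using e generator_mem_principal by simp
  then have fe: "f e \<in> carrier R"
    using f right_idealD(2)[OF assms(2)] by (auto simp: bij_betw_def)
  have "e \<otimes> r \<oplus> f (e \<otimes> r) = (e \<oplus> f e) \<otimes> r" if "r \<in> carrier R" for r
    using f eA e(1) fe that by (simp add: l_distr)
  then have "graph f A = (e \<oplus> f e) <# carrier R"
    unfolding graph_def e(2) l_coset_def by (simp add: image_UN)
  then show ?thesis using principal_right_idealI e(1) fe by simp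
qed

lemma (in ring) zero_mem_principal_right_ideals: "{\<zero>} \<in> principal_right_ideals R"
proof -
  have "\<zero> <# carrier R = {\<zero>}" by (auto simp: l_coset_def)
  then show ?thesis using principal_right_idealI[OF zero_closed] by simp
qed

lemma (in ring) carrier_mem_principal_right_ideals: "carrier R \<in> principal_right_ideals R"
proof -
  have "\<one> <# carrier R = carrier R" by (auto simp: l_coset_def)
  then show ?thesis using principal_right_idealI[OF one_closed] by simp
qed

lemma (in ring) complement_mult:
  assumes "e \<in> carrier R" "x \<in> carrier R"
  shows "(\<one> \<ominus> e) \<otimes> x = x \<ominus> e \<otimes> x" "x \<otimes> (\<one> \<ominus> e) = x \<ominus> x \<otimes> e"
  using assms by (simp_all add: minus_eq l_distr r_distr l_minus r_minus)

context regular_ring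
begin

text \<open>
  If \<open>a y a = a\<close>, then \<open>e = a y\<close> is an idempotent generating \<open>a R\<close>. Membership in \<open>e R\<close> amounts to the
  equation \<open>e x = x\<close>, which is the form used in the computations below.
\<close>

lemma principal_right_ideal_idempotent:
  assumes "I \<in> principal_right_ideals R"
  obtains e where "e \<in> carrier R" "e \<otimes> e = e" "I = {x \<in> carrier R. e \<otimes> x = x}"
proof -
  obtain a where a: "a \<in> carrier R" "I = a <# carrier R"
    using assms by (auto simp: principal_right_ideals_def)
  obtain y where y: "y \<in> carrier R" "a \<otimes> y \<otimes> a = a" using regular[OF a(1)] by auto
  show thesis
  proof
    show "a \<otimes> y \<in> carrier R" using a y by simp
    show "a \<otimes> y \<otimes> (a \<otimes> y) = a \<otimes> y" using a y by (simp flip: m_assoc)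
    have "a \<otimes> y \<otimes> (a \<otimes> r) = a \<otimes> r" if "r \<in> carrier R" for r
      using a y that by (simp flip: m_assoc)
    moreover have "\<exists>r\<in>carrier R. x = a \<otimes> r" if "x \<in> carrier R" "a \<otimes> y \<otimes> x = x" for x
      using a y that by (intro bexI[of _ "y \<otimes> x"]) (simp_all flip: m_assoc)
    ultimately show "I = {x \<in> carrier R. a \<otimes> y \<otimes> x = x}"
      using a by (auto simp: l_coset_def)
  qed
qed

text \<open>
  For \<open>I = e R\<close> and \<open>J = f R\<close>, the elements of \<open>I \<inter> J\<close> are the \<open>x \<in> e R\<close> annihilated by
  \<open>g = (1 - f) e\<close>. If \<open>g y g = g\<close>, the right annihilator of \<open>g\<close> is \<open>(1 - y g) R\<close>, so
  \<open>I \<inter> J\<close> is generated by \<open>e (1 - y g)\<close>.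
\<close>

lemma principal_right_ideals_Int:
  assumes "I \<in> principal_right_ideals R" "J \<in> principal_right_ideals R"
  shows "I \<inter> J \<in> principal_right_ideals R"
proof -
  obtain e where e: "e \<in> carrier R" "e \<otimes> e = e" "I = {x \<in> carrier R. e \<otimes> x = x}"
    using assms(1) by (rule principal_right_ideal_idempotent)
  obtain f where f: "f \<in> carrier R" "f \<otimes> f = f" "J = {x \<in> carrier R. f \<otimes> x = x}"
    using assms(2) by (rule principal_right_ideal_idempotent)
  define g where "g = (\<one> \<ominus> f) \<otimes> e"
  have g: "g \<in> carrier R" using e f by (simp add: g_def)
  obtain y where y: "y \<in> carrier R" "g \<otimes> y \<otimes> g = g" using regular[OF g] by auto
  define c where "c = e \<otimes> (\<one> \<ominus> y \<otimes> g)"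
  have c: "c \<in> carrier R" using e g y by (simp add: c_def)
  have ec: "e \<otimes> c = c" using e g y by (simp add: c_def flip: m_assoc)
  have "(\<one> \<ominus> f) \<otimes> c = g \<otimes> (\<one> \<ominus> y \<otimes> g)"
    using e f g y by (simp add: c_def g_def m_assoc)
  also have "\<dots> = \<zero>"
    using g y by (simp add: complement_mult r_right_minus_eq flip: m_assoc)
  finally have fc: "f \<otimes> c = c" using f c by (simp add: complement_mult r_right_minus_eq)
  have "I \<inter> J = c <# carrier R"
  proof (intro equalityI subsetI)
    fix x assume "x \<in> c <# carrier R"
    then obtain r where r: "r \<in> carrier R" "x = c \<otimes> r" by (auto simp: l_coset_def)
    then show "x \<in> I \<inter> J" using e f c ec fc by (simp flip: m_assoc)
  next
    fix x assume "x \<in> I \<inter> J"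
    then have x: "x \<in> carrier R" "e \<otimes> x = x" "f \<otimes> x = x" using e f by auto
    have "g \<otimes> x = (\<one> \<ominus> f) \<otimes> (e \<otimes> x)" using x e f by (simp add: g_def m_assoc)
    then have gx: "g \<otimes> x = \<zero>" using x f by (simp add: complement_mult r_right_minus_eq)
    have "c \<otimes> x = e \<otimes> ((\<one> \<ominus> y \<otimes> g) \<otimes> x)"
      using e g y x by (simp add: c_def m_assoc)
    also have "(\<one> \<ominus> y \<otimes> g) \<otimes> x = x \<ominus> y \<otimes> (g \<otimes> x)"
      using g y x by (simp add: complement_mult m_assoc)
    finally have "c \<otimes> x = e \<otimes> (x \<ominus> y \<otimes> (g \<otimes> x))" .
    then have "c \<otimes> x = x" using gx x y by (simp add: minus_eq)
    then show "x \<in> c <# carrier R" using x by (force simp: l_coset_def)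
  qed
  then show ?thesis using c principal_right_idealI by simp
qed

text \<open>
  Subtracting components in \<open>e R\<close> shows \<open>e R + b R = e R + g R\<close> for \<open>g = (1 - e) b\<close>. With
  \<open>g R = h R\<close> for an idempotent \<open>h\<close>, which satisfies \<open>e h = 0\<close>, the element \<open>h (1 - e)\<close> is an idempotent
  orthogonal to \<open>e\<close> that also generates \<open>g R\<close>. Hence \<open>k = e + h (1 - e)\<close> is an idempotent generating
  the sum.
\<close>

lemma principal_right_ideals_sum:
  assumes "I \<in> principal_right_ideals R" "J \<in> principal_right_ideals R"
  shows "I <+> J \<in> principal_right_ideals R"
proof -
  obtain e where e: "e \<in> carrier R" "e \<otimes> e = e" "I = {x \<in> carrier R. e \<otimes> x = x}"
    using assms(1) by (rule principal_right_ideal_idempotent)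
  obtain b where b: "b \<in> carrier R" "J = b <# carrier R"
    using assms(2) by (auto simp: principal_right_ideals_def)
  note I = principal_imp_right_ideal[OF assms(1)] and J = principal_imp_right_ideal[OF assms(2)]
  note IJ = right_ideal_sum[OF I J] and u = right_ideal_sum_upper[OF I J]
  define g where "g = (\<one> \<ominus> e) \<otimes> b"
  have g: "g \<in> carrier R" using e b by (simp add: g_def)
  obtain y where y: "y \<in> carrier R" "g \<otimes> y \<otimes> g = g" using regular[OF g] by auto
  define h where "h = g \<otimes> y"
  have h: "h \<in> carrier R" "h \<otimes> g = g" using g y by (simp_all add: h_def)
  have hh: "h \<otimes> h = h" using g y by (simp add: h_def flip: m_assoc)
  have "e \<otimes> g = (e \<otimes> (\<one> \<ominus> e)) \<otimes> b" using e b by (simp add: g_def m_assoc)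
  then have "e \<otimes> g = \<zero>" using e b by (simp add: complement_mult diff_simps)
  then have eh: "e \<otimes> h = \<zero>" using e g y by (simp add: h_def flip: m_assoc)
  define k where "k = e \<oplus> h \<otimes> (\<one> \<ominus> e)"
  have k: "k \<in> carrier R" using e h by (simp add: k_def)
  have "k \<otimes> e = e \<oplus> h \<otimes> ((\<one> \<ominus> e) \<otimes> e)" using e h by (simp add: k_def l_distr m_assoc)
  then have ke: "k \<otimes> e = e" using e h by (simp add: complement_mult diff_simps)
  have "k \<otimes> h = h \<otimes> ((\<one> \<ominus> e) \<otimes> h)" using e h eh by (simp add: k_def l_distr m_assoc)
  then have kh: "k \<otimes> h = h" using e h eh hh by (simp add: complement_mult diff_simps)
  have "k \<otimes> g = (k \<otimes> h) \<otimes> g" using k h g by (simp add: m_assoc)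
  then have kg: "k \<otimes> g = g" using kh h by simp
  have kR: "right_ideal (k <# carrier R)" using k by (rule right_ideal_principal)
  have kI: "x \<in> k <# carrier R" if "x \<in> carrier R" "k \<otimes> x = x" for x
    using that by (force simp: l_coset_def)
  have "I \<subseteq> k <# carrier R"
  proof
    fix x assume "x \<in> I"
    then have x: "x \<in> carrier R" "e \<otimes> x = x" using e by auto
    have "k \<otimes> x = (k \<otimes> e) \<otimes> x" using k e x by (simp add: m_assoc)
    then show "x \<in> k <# carrier R" using kI x ke by simp
  qed
  moreover have "J \<subseteq> k <# carrier R"
  proof -
    have "g \<oplus> e \<otimes> b = b"
      using e b by (simp add: g_def complement_mult diff_simps)
    moreover have "k \<otimes> (g \<oplus> e \<otimes> b) = g \<oplus> e \<otimes> b"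
      using k g e b ke kg by (simp add: r_distr flip: m_assoc)
    ultimately have kb: "k \<otimes> b = b" by simp
    show ?thesis
    proof
      fix x assume "x \<in> J"
      then obtain r where "r \<in> carrier R" "x = b \<otimes> r" using b by (auto simp: l_coset_def)
      then show "x \<in> k <# carrier R" using kI[of x] kb k b by (simp flip: m_assoc)
    qed
  qed
  ultimately have "I <+> J \<subseteq> k <# carrier R" using right_ideal_sum_least[OF kR] by blast
  moreover have "k \<in> I <+> J"
  proof -
    have "e \<in> I <+> J" using u(1) e by auto
    moreover have "g \<in> I <+> J"
    proof -
      have "b \<in> J" using b generator_mem_principal by simp
      moreover have "e \<otimes> b \<in> I" using e b by (simp flip: m_assoc)
      moreover have "g = b \<ominus> e \<otimes> b" using e b by (simp add: g_def complement_mult)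
      ultimately show ?thesis using right_idealD(7)[OF IJ, of b "e \<otimes> b"] u by auto
    qed
    moreover have "k = e \<oplus> g \<otimes> (y \<otimes> (\<one> \<ominus> e))"
      using e g y by (simp add: k_def h_def m_assoc)
    ultimately show ?thesis
      using right_idealD(4)[OF IJ] right_idealD(5)[OF IJ] e y by simp
  qed
  then have "k <# carrier R \<subseteq> I <+> J" using right_idealD(5)[OF IJ] by (auto simp: l_coset_def)
  ultimately have "I <+> J = k <# carrier R" by blast
  then show ?thesis using k principal_right_idealI by simp
qed

lemma principal_right_ideal_complement:
  assumes "I \<in> principal_right_ideals R"
  obtains J where "J \<in> principal_right_ideals R" "direct_sum I J (carrier R)"
proof -
  obtain e where e: "e \<in> carrier R" "e \<otimes> e = e" "I = {x \<in> carrier R. e \<otimes> x = x}"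
    using assms(1) by (rule principal_right_ideal_idempotent)
  define J where "J = (\<one> \<ominus> e) <# carrier R"
  have J: "J \<in> principal_right_ideals R" using e principal_right_idealI by (simp add: J_def)
  note rI = principal_imp_right_ideal[OF assms(1)] and rJ = principal_imp_right_ideal[OF J]
  have "direct_sum I J (carrier R)"
  proof (rule direct_sumI[OF rI rJ])
    have "x \<in> I <+> J" if x: "x \<in> carrier R" for x
    proof -
      have "e \<otimes> x \<in> I" using e x by (simp flip: m_assoc)
      moreover have "(\<one> \<ominus> e) \<otimes> x \<in> J" using x by (auto simp: J_def l_coset_def)
      moreover have "x = e \<otimes> x \<oplus> (\<one> \<ominus> e) \<otimes> x"
        using e x by (simp add: complement_mult diff_simps)
      ultimately show ?thesis unfolding set_add_iff by blast
    qed
    then show "I <+> J = carrier R" using right_idealD(1)[OF right_ideal_sum[OF rI rJ]] by blast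
  next
    fix x assume "x \<in> I" "x \<in> J"
    then obtain r where r: "r \<in> carrier R" "x = (\<one> \<ominus> e) \<otimes> r" by (auto simp: J_def l_coset_def)
    have "e \<otimes> x = (e \<otimes> (\<one> \<ominus> e)) \<otimes> r" using r e by (simp add: m_assoc)
    then have "e \<otimes> x = \<zero>" using e r by (simp add: complement_mult diff_simps)
    then show "x = \<zero>" using \<open>x \<in> I\<close> e by simp
  qed
  then show thesis using that J by blast
qed

text \<open>
  By modularity, a complement of \<open>I\<close> in \<open>R\<close> cuts \<open>M\<close> in a complement of \<open>I\<close> in \<open>M\<close>.
\<close>

lemma principal_right_ideal_relative_complement:
  assumes "I \<in> principal_right_ideals R" "M \<in> principal_right_ideals R" "I \<subseteq> M"
  obtains J where "J \<in> principal_right_ideals R" "direct_sum I J M"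
proof -
  obtain K where K: "K \<in> principal_right_ideals R" "direct_sum I K (carrier R)"
    using assms(1) by (rule principal_right_ideal_complement)
  note ds = direct_sumD[OF K(2)] and M = principal_imp_right_ideal[OF assms(2)]
  have J: "M \<inter> K \<in> principal_right_ideals R"
    using assms(2) K(1) by (rule principal_right_ideals_Int)
  note rJ = principal_imp_right_ideal[OF J]
  have "direct_sum I (M \<inter> K) M"
  proof (rule direct_sumI[OF ds(1) rJ])
    have "x \<in> I <+> M \<inter> K" if x: "x \<in> M" for x
    proof -
      obtain i j where ij: "i \<in> I" "j \<in> K" "x = i \<oplus> j"
        using right_idealD(2)[OF M x] ds(3) set_add_iff[of x I K] by blast
      then have "x \<ominus> i = j"
        using right_idealD(2)[OF ds(1)] right_idealD(2)[OF ds(2)] by (simp add: add_diff_cancel)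
      then have "j \<in> M" using right_idealD(7)[OF M x, of i] ij(1) assms(3) by auto
      then show ?thesis using ij unfolding set_add_iff by blast
    qed
    then show "I <+> M \<inter> K = M"
      using right_ideal_sum_least[OF M assms(3), of "M \<inter> K"] by blast
  next
    fix x assume "x \<in> I" "x \<in> M \<inter> K"
    then show "x = \<zero>" using ds(4) by blast
  qed
  then show thesis using that J by blast
qed

section \<open>Lattice operations, height and perspectivity\<close>

lemma carrier_pri_lattice: "carrier (pri_lattice R) = principal_right_ideals R"
  and le_pri_lattice: "le (pri_lattice R) = (\<subseteq>)"
  by (simp_all add: pri_lattice_def)

lemma least_pri_lattice:
  "least (pri_lattice R) I S \<longleftrightarrow> S \<subseteq> principal_right_ideals R \<and> I \<in> S \<and> (\<forall>J\<in>S. I \<subseteq> J)"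
  by (simp add: least_def pri_lattice_def)

lemma greatest_pri_lattice:
  "greatest (pri_lattice R) I S \<longleftrightarrow> S \<subseteq> principal_right_ideals R \<and> I \<in> S \<and> (\<forall>J\<in>S. J \<subseteq> I)"
  by (simp add: greatest_def pri_lattice_def)

lemma bottom_pri_lattice: "\<bottom>\<^bsub>pri_lattice R\<^esub> = {\<zero>}"
proof -
  have "\<zero> \<in> I" if "I \<in> principal_right_ideals R" for I
    using right_idealD(3) principal_imp_right_ideal that by blast
  then show ?thesis
    unfolding bottom_def least_pri_lattice carrier_pri_lattice
    by (intro some_equality) (use zero_mem_principal_right_ideals in blast)+
qed

lemma top_pri_lattice: "\<top>\<^bsub>pri_lattice R\<^esub> = carrier R"
proof -
  have "I \<subseteq> carrier R" if "I \<in> principal_right_ideals R" for I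
    using right_idealD(1) principal_imp_right_ideal that by blast
  then show ?thesis
    unfolding top_def greatest_pri_lattice carrier_pri_lattice
    by (intro some_equality) (use carrier_mem_principal_right_ideals in blast)+
qed

lemma join_pri_lattice:
  assumes "I \<in> principal_right_ideals R" "J \<in> principal_right_ideals R"
  shows "I \<squnion>\<^bsub>pri_lattice R\<^esub> J = I <+> J"
proof -
  note r = assms[THEN principal_imp_right_ideal]
  have U: "Upper (pri_lattice R) {I, J} = {K \<in> principal_right_ideals R. I \<subseteq> K \<and> J \<subseteq> K}"
    using assms by (auto simp: Upper_def pri_lattice_def)
  have least: "I <+> J \<subseteq> K" if "K \<in> principal_right_ideals R" "I \<subseteq> K" "J \<subseteq> K" for K
    using right_ideal_sum_least[OF principal_imp_right_ideal] that by blast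
  show ?thesis
    unfolding join_def Lattice.sup_def least_pri_lattice U
    using principal_right_ideals_sum[OF assms] right_ideal_sum_upper[OF r] least
    by (intro some_equality) blast+
qed

lemma meet_pri_lattice:
  assumes "I \<in> principal_right_ideals R" "J \<in> principal_right_ideals R"
  shows "I \<sqinter>\<^bsub>pri_lattice R\<^esub> J = I \<inter> J"
proof -
  have U: "Lower (pri_lattice R) {I, J} = {K \<in> principal_right_ideals R. K \<subseteq> I \<and> K \<subseteq> J}"
    using assms by (auto simp: Lower_def pri_lattice_def)
  show ?thesis
    unfolding meet_def Lattice.inf_def greatest_pri_lattice U
    using principal_right_ideals_Int[OF assms] by (intro some_equality) blast+
qed

lemma complements_iff_direct_sum:
  "complements (pri_lattice R) I J \<longleftrightarrow>
     I \<in> principal_right_ideals R \<and> J \<in> principal_right_ideals R \<and> direct_sum I J (carrier R)"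
  using principal_imp_right_ideal[of I] principal_imp_right_ideal[of J]
  by (auto simp: complements_def carrier_pri_lattice join_pri_lattice meet_pri_lattice
      bottom_pri_lattice top_pri_lattice direct_sum_def)

text \<open>
  Induction along a finite maximal chain \<open>C\<close> below \<open>D\<close>: each nonzero member \<open>Z\<close> covers its predecessor
  \<open>W\<close> in \<open>C\<close>, because by maximality no principal right ideal lies strictly between them. A complement
  \<open>S\<close> of \<open>W\<close> in \<open>Z\<close> is therefore simple: a nonzero \<open>x \<in> S\<close> gives \<open>W + x R = Z\<close>, and then
  \<open>S = x R\<close>.
\<close>

lemma finite_height_imp_finite_semisimple:
  assumes "D \<in> principal_right_ideals R" "finite_height (pri_lattice R) D"
  shows "finite_semisimple D"
proof -
  define L where "L = {I \<in> principal_right_ideals R. I \<subseteq> D}"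
  have "\<lbrace>\<bottom>\<^bsub>pri_lattice R\<^esub>..D\<rbrace>\<^bsub>pri_lattice R\<^esub> = L"
    using right_idealD(3) principal_imp_right_ideal
    by (auto simp: at_least_at_most_def bottom_pri_lattice carrier_pri_lattice le_pri_lattice L_def)
  then obtain C d where C: "pred_on.maxchain L (\<subseteq>) C" and "card C = Suc d"
    using assms(2) unfolding finite_height_def has_height_def le_pri_lattice by auto
  then have "finite C" using card_ge_0_finite[of C] by simp
  have CL: "C \<subseteq> L" and chain: "Z \<subseteq> Y \<or> Y \<subseteq> Z" if "Z \<in> C" "Y \<in> C" for Z Y
    using C that by (auto simp: pred_on.maxchain_def pred_on.chain_def)
  \<comment> \<open>By maximality, whatever is comparable with all of \<open>C\<close> already belongs to \<open>C\<close>.\<close>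
  have mem: "I \<in> C" if "I \<in> L" "\<And>Y. Y \<in> C \<Longrightarrow> I \<subseteq> Y \<or> Y \<subseteq> I" for I
  proof (rule ccontr)
    assume "I \<notin> C"
    moreover have "pred_on.chain L (\<subseteq>) (insert I C)"
      using C that by (auto simp: pred_on.maxchain_def pred_on.chain_def)
    ultimately show False using C by (auto simp: pred_on.maxchain_def)
  qed
  have zero: "\<zero> \<in> I" if "I \<in> principal_right_ideals R" for I
    using right_idealD(3) principal_imp_right_ideal that by blast
  have "{\<zero>} \<in> C"
    using zero assms(1) CL by (intro mem) (auto simp: L_def zero_mem_principal_right_ideals)
  have "finite_semisimple Z" if "Z \<in> C" for Z
    using that
  proof (induction "card {Y \<in> C. Y \<subset> Z}" arbitrary: Z rule: less_induct)
    case less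
    show ?case
    proof (cases "Z = {\<zero>}")
      case True
      then show ?thesis using finite_semisimple.zero by simp
    next
      case False
      define K where "K = {Y \<in> C. Y \<subset> Z}"
      have Z: "Z \<in> principal_right_ideals R" "Z \<subseteq> D" using less(2) CL by (auto simp: L_def)
      have "{\<zero>} \<in> K" using \<open>{\<zero>} \<in> C\<close> False zero[OF Z(1)] by (auto simp: K_def)
      moreover have finK: "finite K" using \<open>finite C\<close> by (simp add: K_def)
      ultimately obtain W where W: "W \<in> K" "\<And>Y. Y \<in> K \<Longrightarrow> W \<subseteq> Y \<Longrightarrow> W = Y"
        using finite_has_maximal[of K] by auto
      have WC: "W \<in> C" "W \<subset> Z" using W by (auto simp: K_def)
      have W_max: "Y \<subseteq> W" if "Y \<in> K" for Y
        using W(2)[OF that] chain[OF WC(1), of Y] that by (auto simp: K_def)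
      have Wp: "W \<in> principal_right_ideals R" using WC CL by (auto simp: L_def)
      \<comment> \<open>A principal right ideal between \<open>W\<close> and \<open>Z\<close> is comparable with every member of the chain.\<close>
      have covers: "I = Z" if I: "I \<in> principal_right_ideals R" "W \<subset> I" "I \<subseteq> Z" for I
      proof (rule ccontr)
        assume "I \<noteq> Z"
        have "I \<in> C"
        proof (rule mem)
          show "I \<in> L" using I Z by (auto simp: L_def)
          fix Y assume Y: "Y \<in> C"
          show "I \<subseteq> Y \<or> Y \<subseteq> I"
            using chain[OF Y less(2)] W_max[of Y] I Y by (auto simp: K_def)
        qed
        then show False using W_max[of I] I \<open>I \<noteq> Z\<close> by (auto simp: K_def)
      qed
      have "card {Y \<in> C. Y \<subset> W} < card {Y \<in> C. Y \<subset> Z}"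
        using WC finK by (intro psubset_card_mono) (auto simp: K_def)
      then have IH: "finite_semisimple W" using less(1) WC(1) by blast
      obtain S where S: "S \<in> principal_right_ideals R" "direct_sum W S Z"
        using principal_right_ideal_relative_complement[OF Wp Z(1)] WC(2) by blast
      note ds = direct_sumD[OF S(2)]
      have "simple_right_ideal S"
        unfolding simple_right_ideal_def
      proof (intro conjI ballI impI)
        show "right_ideal S" by (rule ds(2))
        show "S \<noteq> {\<zero>}"
        proof
          assume "S = {\<zero>}"
          then have "Z \<subseteq> W" using right_ideal_sum_least[OF ds(1), of W S] ds(3)
              right_idealD(3)[OF ds(1)] by blast
          then show False using WC(2) by blast
        qed
      next
        fix x assume x: "x \<in> S" "x \<noteq> \<zero>"
        have xR: "x \<in> carrier R" using right_idealD(2)[OF ds(2)] x by blast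
        define P where "P = x <# carrier R"
        have P: "P \<in> principal_right_ideals R" unfolding P_def using xR by (rule principal_right_idealI)
        note rP = principal_imp_right_ideal[OF P]
        have xP: "x \<in> P" using xR generator_mem_principal by (simp add: P_def)
        have PS: "P \<subseteq> S" using right_idealD(5)[OF ds(2) x(1)] by (auto simp: P_def l_coset_def)
        note u = right_ideal_sum_upper[OF ds(1) rP]
        have "W <+> P = Z"
        proof (rule covers)
          show "W <+> P \<in> principal_right_ideals R" using Wp P by (rule principal_right_ideals_sum)
          show "W \<subset> W <+> P" using u xP x ds(4) by blast
          show "W <+> P \<subseteq> Z" using right_ideal_sum_least[OF ds(5,6), of P] PS ds(7) by blast
        qed
        show "S \<subseteq> x <# carrier R"
        proof
          fix s assume s: "s \<in> S"
          then obtain w p where wp: "w \<in> W" "p \<in> P" "s = w \<oplus> p"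
            using \<open>W <+> P = Z\<close> ds(7) set_add_iff[of s W P] by blast
          then have c: "w \<in> carrier R" "p \<in> carrier R"
            using right_idealD(2)[OF ds(1)] right_idealD(2)[OF rP] by auto
          have "w = s \<ominus> p" using wp c by (simp add: add_diff_cancel)
          then have "w \<in> S" using right_idealD(7)[OF ds(2) s, of p] wp(2) PS by auto
          then have "w = \<zero>" using wp(1) ds(4) by blast
          then show "s \<in> x <# carrier R" using wp c by (simp add: P_def)
        qed
      qed
      then show ?thesis using IH finite_semisimple.add_simple direct_sum_commute[OF S(2)] by blast
    qed
  qed
  moreover have "D \<in> C" using assms(1) CL by (intro mem) (auto simp: L_def)
  ultimately show ?thesis by blast
qed

lemma perspective_imp_isomorphic:
  assumes "perspective (pri_lattice R) A B"
  shows "right_module_isomorphic R A B"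
  using assms common_complement_imp_isomorphic
  by (auto simp: perspective_def complements_iff_direct_sum)

text \<open>
  The finite height of \<open>A \<inter> B\<close> allows its cancellation from \<open>A \<cong> B\<close>. The graph of the resulting
  isomorphism is a common complement of \<open>A\<close> and \<open>B\<close> in \<open>A + B\<close>; adding a complement of \<open>A + B\<close> makes
  it one in \<open>R\<close>.
\<close>

lemma isomorphic_imp_perspective:
  assumes A: "A \<in> principal_right_ideals R" and B: "B \<in> principal_right_ideals R"
    and fin: "finite_height (pri_lattice R) (A \<inter> B)"
    and iso: "right_module_isomorphic R A B"
  shows "perspective (pri_lattice R) A B"
proof -
  have D: "A \<inter> B \<in> principal_right_ideals R" using A B by (rule principal_right_ideals_Int)
  obtain A' where A': "A' \<in> principal_right_ideals R" "direct_sum (A \<inter> B) A' A"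
    using principal_right_ideal_relative_complement[OF D A] by blast
  obtain B' where B': "B' \<in> principal_right_ideals R" "direct_sum (A \<inter> B) B' B"
    using principal_right_ideal_relative_complement[OF D B] by blast
  have "right_module_isomorphic R A' B'"
    using cancel_finite_semisimple[OF finite_height_imp_finite_semisimple[OF D fin]
        A'(2) B'(2) iso] .
  then obtain f where f: "right_module_iso R A' B' f" by (auto simp: right_module_isomorphic_def)
  note G = graph_common_complement[OF A'(2) B'(2) f]
  obtain E where E: "E \<in> principal_right_ideals R" "direct_sum (A <+> B) E (carrier R)"
    using principal_right_ideals_sum[OF A B] by (rule principal_right_ideal_complement)
  have "graph f A' <+> E \<in> principal_right_ideals R"
    using principal_right_ideals_sum[OF principal_graph[OF A'(1) direct_sumD(2)[OF B'(2)] f] E(1)] .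
  then show ?thesis
    using A B direct_sum_assoc(2)[OF G(1) E(2)] direct_sum_assoc(2)[OF G(2) E(2)]
    unfolding perspective_def complements_iff_direct_sum by blast
qed

end

theorem corollary17:
  fixes R :: "('a, 'm) ring_scheme" and A B :: "'a set"
  assumes "regular_ring R"
    and "A \<in> carrier (pri_lattice R)"
    and "B \<in> carrier (pri_lattice R)"
    and "finite_height (pri_lattice R) (A \<inter> B)"
  shows "perspective (pri_lattice R) A B \<longleftrightarrow> right_module_isomorphic R A B"
proof -
  interpret regular_ring R by (rule assms(1))
  have "A \<in> principal_right_ideals R" "B \<in> principal_right_ideals R"
    using assms(2,3) by (simp_all add: carrier_pri_lattice)
  then show ?thesis
    using perspective_imp_isomorphic isomorphic_imp_perspective assms(4) by blast
qed

end
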